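(* Let $k\ge 1$ and let $A$ be a primitive set contained in $\mathbb{N}_{\ge k}=\{n\in\mathbb{N}:\Omega(n)\ge k\}$. Then for any set $\mathcal{Q}$ of odd primes, $$f(A(\mathcal{Q}))\le f(\mathbb{N}_k(\mathcal{Q})),$$ where $A(\mathcal{Q})$ is the set of elements of $A$ all of whose prime factors lie in $\mathcal{Q}$, and $\mathbb{N}_k(\mathcal{Q})$ is the set of natural numbers $n$ with $\Omega(n)=k$ all of whose prime factors lie in $\mathcal{Q}$.
   Context: $\mathbb{N}=\{1,2,3,\dots\}$; $\Omega(n)$ is the number of prime factors of $n$ counted with multiplicity. A set $A\subset\mathbb{N}$ is primitive if no element of $A$ divides another distinct element of $A$. For a set $B$ of integers $\ge 2$, $f(B)\coloneq\sum_{b\in B}\frac{1}{b\log b}$ (possibly $+\infty$). *)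

theory Defs
  imports "HOL-Analysis.Analysis" "HOL-Computational_Algebra.Primes"
begin

definition bigOmega :: "nat \<Rightarrow> nat" where
  "bigOmega n = size (prime_factorization n)"

definition primitive :: "nat set \<Rightarrow> bool" where
  "primitive A \<longleftrightarrow> (\<forall>a\<in>A. \<forall>b\<in>A. a dvd b \<longrightarrow> a = b)"

definition fsum :: "nat set \<Rightarrow> ennreal" where
  "fsum B = (\<Sum>\<^sub>\<infinity> b\<in>B. ennreal (1 / (real b * ln (real b))))"

definition restrict_primes :: "nat set \<Rightarrow> nat set \<Rightarrow> nat set" where
  "restrict_primes A Q = {a \<in> A. prime_factors a \<subseteq> Q}"

end

theory Submission
  imports Defs "HOL-Real_Asymp.Real_Asymp"
begin

text \<open>
  Work with odd integers and put \<open>\<alpha>\<^sub>p = 1 / (p - 2)\<close>, \<open>L(m) = ln m\<close>,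
  \<open>D(m) = \<Sum> v\<^sub>p(m) \<alpha>\<^sub>p ln p\<close> and \<open>S = L + D\<close>.  Move from \<open>m\<close> to \<open>m / p\<close> with
  probability \<open>L(m) J(m, p)\<close>, where
  \<open>J(m, p) = v\<^sub>p(m) ln p ((1 + \<alpha>\<^sub>p) / S(m)\<^sup>2 + \<alpha>\<^sub>p / (S(m) L(m)))\<close>; these add up to 1.
  Each step lowers \<open>\<Omega>\<close> by one, and if every \<open>m\<close> carries mass at most
  \<open>1 / (m ln m)\<close>, then the mass arriving at any \<open>n > 1\<close> is at most \<open>1 / (n ln n)\<close>.
  So the mass of a finite primitive set can be pushed down to level \<open>k\<close> one level at a
  time without loss and without ever exceeding this bound: primitivity ensures that the mass
  coming from above never lands on an element of the set.

  The bound on the arriving mass reads \<open>\<Sum>\<^sub>p J(n p, p) / p \<le> 1 / ln n\<close>.  The choice of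
  \<open>\<alpha>\<^sub>p\<close> makes \<open>(1 + \<alpha>\<^sub>p) / p + \<alpha>\<^sub>p / p = \<alpha>\<^sub>p\<close>, so that the terms containing
  \<open>v\<^sub>p(n)\<close> are paid for by \<open>D(n) / (S L) = 1 / L - 1 / S\<close>; this is where \<open>p = 2\<close>
  must be excluded.  The remaining terms are bounded by
  \<open>\<Sum>\<^sub>p ln p / ((p - 2) (S + ln p)\<^sup>2) \<le> 1 / S\<close>, which is the Laplace transform of
  \<open>\<Sum>\<^sub>p ln p p\<^sup>-\<^sup>\<sigma> / (p - 2) \<le> 1 / \<sigma>\<close>.  The latter follows from the
  bound \<open>1 / \<sigma> - 1 / (2 (1 + \<sigma>))\<close> for \<open>-\<zeta>'(1 + \<sigma>) / \<zeta>(1 + \<sigma>) = \<Sum>\<^sub>p ln p / (p\<^sup>1\<^sup>+\<^sup>\<sigma> - 1)\<close>: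
  the term for \<open>p = 2\<close>, which is not needed, compensates for \<open>1 / (p - 2)\<close> being larger than
  \<open>1 / (p - 1)\<close>.
\<close>

section \<open>Partial sums of zeta and its derivative\<close>

text \<open>The trapezoidal rule overestimates the integral of the convex function
  \<open>1 / x\<close>, and the trapezoids over \<open>[1, n]\<close> add up to
  \<open>harm n - 1/2 - 1 / (2 * n)\<close>.\<close>

lemma harm_lower:
  assumes "n \<ge> 1"
  shows "ln (real n) + 1/2 + 1 / (2 * real n) \<le> harm n"
  using assms
proof (induction n rule: dec_induct)
  case base
  then show ?case by (simp add: harm_def)
next
  case (step n)
  have "ln (real n + 1) - ln (real n) \<le> 1 * (inverse (real n) + inverse (real n + 1)) / 2"
    using step by (intro ln_inverse_approx_le) auto
  moreover have "harm (Suc n) = harm n + inverse (real n + 1)"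
    by (simp add: harm_Suc add.commute)
  moreover have "inverse (real n) = 1 / (2 * real n) + 1 / (2 * real n)"
      "inverse (real n + 1) = 1 / (2 * (real n + 1)) + 1 / (2 * (real n + 1))"
    using step by (simp_all add: divide_simps)
  ultimately show ?case
    using step.IH by (simp add: add.commute)
qed

text \<open>The step inequality for the Abel summation below. Bounding \<open>harm n - 1/2\<close>
  below by \<open>ln (n + 1) * (2 * n + 1) / (2 * (n + 1))\<close> and the logarithmic increment by
  the midpoint value \<open>2 / (2 * n + 1)\<close> yields exactly the left side as product.\<close>

lemma harm_ln_step:
  assumes "n \<ge> 1"
  shows "ln (real n + 1) / (real n + 1) \<le> (harm n - 1/2) * (ln (real n + 1) - ln (real n))"
proof (cases "n = 1")
  case True
  then show ?thesis by (simp add: harm_def)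
next
  case False
  with assms have n: "n \<ge> 2" by simp
  define x where "x = real n"
  have x: "x \<ge> 2" using n by (simp add: x_def)
  have lo: "ln (x + 1) - ln x \<ge> 2 * (x + 1 - x) / (x + (x + 1))"
    using x by (intro ln_inverse_approx_ge) auto
  have up: "ln (x + 1) - ln x \<le> 1 * (inverse x + inverse (x + 1)) / 2"
    using x by (intro ln_inverse_approx_le) auto
  have h: "ln x + 1/2 + 1 / (2 * x) \<le> harm n" using harm_lower[of n] n by (simp add: x_def)
  \<comment> \<open>\<open>ln (x + 1) >= 1\<close> turns the correction
    \<open>1 / (2 * (x + 1))\<close> into a multiple of \<open>ln (x + 1)\<close>. This fails for
    \<open>n = 1\<close>, where the claim is an equality.\<close>
  have "exp 1 \<le> x + 1" using exp_le x by linarith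
  hence l1: "1 \<le> ln (x + 1)" using x by (subst ln_ge_iff) auto
  have "1 / (2 * (x + 1)) \<le> ln (x + 1) / (2 * (x + 1))"
    using l1 x by (intro divide_right_mono) auto
  moreover have "1 * (inverse x + inverse (x + 1)) / 2 = 1 / (2 * x) + 1 / (2 * (x + 1))"
    by (simp add: inverse_eq_divide add_divide_distrib mult.commute)
  ultimately have "ln (x + 1) - ln (x + 1) / (2 * (x + 1)) \<le> harm n - 1/2"
    using h up by linarith
  hence "ln (x + 1) * (2 * x + 1) / (2 * (x + 1)) \<le> harm n - 1/2"
    using x by (simp add: field_simps)
  moreover have "0 \<le> ln (x + 1) * (2 * x + 1) / (2 * (x + 1))"
    using l1 x by auto
  moreover from calculation have "0 \<le> harm n - (1/2 :: real)"
    by linarith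
  ultimately have "ln (x + 1) * (2 * x + 1) / (2 * (x + 1)) * (2 / (2 * x + 1))
      \<le> (harm n - 1/2) * (ln (x + 1) - ln x)"
    using lo x by (intro mult_mono) auto
  also have "ln (x + 1) * (2 * x + 1) / (2 * (x + 1)) * (2 / (2 * x + 1)) = ln (x + 1) / (x + 1)"
    using x by (simp add: divide_simps)
  finally show ?thesis by (simp add: x_def)
qed

text \<open>This is \<open>exp t >= 1 + t\<close> at
  \<open>t = \<sigma> * (ln (x + 1) - ln x)\<close>. It makes the increments in the two sums below
  telescope.\<close>

lemma powr_neg_diff:
  fixes x \<sigma> :: real
  assumes "x > 0" "\<sigma> > 0"
  shows "\<sigma> * (x + 1) powr -\<sigma> * (ln (x + 1) - ln x) \<le> x powr -\<sigma> - (x + 1) powr -\<sigma>"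
proof -
  have "1 + \<sigma> * (ln (x + 1) - ln x) \<le> exp (\<sigma> * (ln (x + 1) - ln x))"
    by (rule exp_ge_add_one_self)
  hence "(x + 1) powr -\<sigma> * (1 + \<sigma> * (ln (x + 1) - ln x))
      \<le> (x + 1) powr -\<sigma> * exp (\<sigma> * (ln (x + 1) - ln x))"
    by (intro mult_left_mono) auto
  also have "\<dots> = x powr -\<sigma>"
    using assms by (simp add: powr_def flip: exp_add) (simp add: algebra_simps)
  finally show ?thesis by (simp add: algebra_simps)
qed

text \<open>
  The last term is the boundary term of the Abel summation of \<open>\<Sum> n\<^sup>-\<^sup>1 n\<^sup>-\<^sup>\<sigma>\<close> against the
  harmonic numbers; it makes the induction go through.
\<close>

lemma sum_ln_powr_le:
  fixes \<sigma> :: real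
  assumes "\<sigma> > 0" "M \<ge> 1"
  shows "\<sigma> * (\<Sum>n=1..M. ln (real n) * real n powr -(1 + \<sigma>))
    \<le> (\<Sum>n=1..M. real n powr -(1 + \<sigma>)) - 1/2 - (harm M - 1/2) * real M powr -\<sigma>"
  using assms(2)
proof (induction M rule: dec_induct)
  case base
  then show ?case by (simp add: harm_def)
next
  case (step M)
  define x where "x = real M"
  have x: "x \<ge> 1" using step by (simp add: x_def)
  have "0 \<le> ln (real M)" "0 \<le> 1 / (2 * real M)" using step by auto
  hence h: "1/2 \<le> (harm M :: real)" using harm_lower[of M] step by linarith
  have e: "(x + 1) powr -(1 + \<sigma>) = (x + 1) powr -\<sigma> / (x + 1)"
    using x by (simp add: powr_diff powr_minus divide_simps powr_add)
  have "\<sigma> * (ln (x + 1) * (x + 1) powr -(1 + \<sigma>))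
      = \<sigma> * (x + 1) powr -\<sigma> * (ln (x + 1) / (x + 1))"
    unfolding e by simp
  also have "\<dots> \<le> \<sigma> * (x + 1) powr -\<sigma> * ((harm M - 1/2) * (ln (x + 1) - ln x))"
    using harm_ln_step[of M] step assms by (intro mult_left_mono) (auto simp: x_def)
  also have "\<dots> = (harm M - 1/2) * (\<sigma> * (x + 1) powr -\<sigma> * (ln (x + 1) - ln x))"
    by simp
  also have "\<dots> \<le> (harm M - 1/2) * (x powr -\<sigma> - (x + 1) powr -\<sigma>)"
    using h x assms by (intro mult_left_mono powr_neg_diff) auto
  finally have *: "\<sigma> * (ln (x + 1) * (x + 1) powr -(1 + \<sigma>))
    \<le> (harm M - 1/2) * (x powr -\<sigma> - (x + 1) powr -\<sigma>)" .
  have hs: "harm (Suc M) = harm M + 1 / (x + 1)"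
    by (simp add: harm_Suc x_def inverse_eq_divide add.commute)
  \<comment> \<open>The harmonic increment reproduces the new summand of the zeta sum, so the two
    cancel on the right side.\<close>
  have "(harm (Suc M) - 1/2) * (x + 1) powr -\<sigma>
      = (harm M - 1/2) * (x + 1) powr -\<sigma> + (x + 1) powr -(1 + \<sigma>)"
    unfolding hs e by (simp add: algebra_simps)
  moreover have Suc_M: "real (Suc M) = x + 1" by (simp add: x_def)
  moreover have "(harm M - 1/2) * (x powr -\<sigma> - (x + 1) powr -\<sigma>)
      = (harm M - 1/2) * x powr -\<sigma> - (harm M - 1/2) * (x + 1) powr -\<sigma>"
    by (rule right_diff_distrib)
  ultimately show ?case
    using * step.IH unfolding x_def[symmetric]
    by (simp add: Suc_M distrib_left del: of_nat_Suc)
qed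

text \<open>Comparison with the integral over \<open>[1, M]\<close>; in the limit it gives \<zeta>(1
  + \<sigma>) \<le> 1 + 1 / \<sigma>.\<close>

lemma sum_powr_le:
  fixes \<sigma> :: real
  assumes "\<sigma> > 0" "M \<ge> 1"
  shows "(\<Sum>n=1..M. real n powr -(1 + \<sigma>)) \<le> 1 + 1 / \<sigma> - real M powr -\<sigma> / \<sigma>"
  using assms(2)
proof (induction M rule: dec_induct)
  case base
  then show ?case by simp
next
  case (step M)
  define x where "x = real M"
  have x: "x \<ge> 1" using step by (simp add: x_def)
  have e: "(x + 1) powr -(1 + \<sigma>) = (x + 1) powr -\<sigma> * (1 / (x + 1))"
    using x by (simp add: powr_diff powr_minus divide_simps powr_add)
  have "1 / (x + 1) \<le> ln (x + 1) - ln x"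
    using ln_diff_le[of x "x + 1"] x by (simp add: field_simps)
  hence "\<sigma> * (x + 1) powr -\<sigma> * (1 / (x + 1)) \<le> \<sigma> * (x + 1) powr -\<sigma> * (ln (x + 1) - ln x)"
    using assms by (intro mult_left_mono) auto
  also have "\<dots> \<le> x powr -\<sigma> - (x + 1) powr -\<sigma>"
    using x assms by (intro powr_neg_diff) auto
  finally have "(x + 1) powr -(1 + \<sigma>) \<le> (x powr -\<sigma> - (x + 1) powr -\<sigma>) / \<sigma>"
    using assms unfolding e by (simp add: field_simps)
  with step.IH show ?case
    by (simp add: x_def[symmetric] add.commute[of 1 x] diff_divide_distrib)
qed

section \<open>From sums over integers to sums over primes\<close>

lemma ln_eq_sum_multiplicity:
  assumes "n > 0"
  shows "ln (real n) = (\<Sum>p\<in>prime_factors n. real (multiplicity p n) * ln (real p))"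
proof -
  have "real n = (\<Prod>p\<in>prime_factors n. real p ^ multiplicity p n)"
    using prime_factorization_nat[OF assms] by (metis (no_types, lifting) of_nat_power of_nat_prod prod.cong)
  also have "ln \<dots> = (\<Sum>p\<in>prime_factors n. ln (real p ^ multiplicity p n))"
    by (rule ln_prod) (auto dest!: in_prime_factors_imp_prime prime_gt_0_nat)
  finally show ?thesis
    by (simp add: ln_realpow)
qed

lemma sum_multiplicity_ln_le:
  assumes "n > 0" "finite F" "\<And>p. p \<in> F \<Longrightarrow> prime p"
  shows "(\<Sum>p\<in>F. real (multiplicity p n) * ln (real p)) \<le> ln (real n)"
proof -
  have "(\<Sum>p\<in>F. real (multiplicity p n) * ln (real p))
      = (\<Sum>p\<in>F \<inter> prime_factors n. real (multiplicity p n) * ln (real p))"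
    using assms by (intro sum.mono_neutral_right) (auto simp: prime_factors_multiplicity)
  also have "\<dots> \<le> (\<Sum>p\<in>prime_factors n. real (multiplicity p n) * ln (real p))"
    by (intro sum_mono2) (auto dest!: in_prime_factors_imp_prime prime_gt_0_nat)
  finally show ?thesis
    using ln_eq_sum_multiplicity[OF assms(1)] by simp
qed

text \<open>Let \<open>z\<close> be the limit of the sums \<open>Z M\<close>. The Dirichlet series
  of the multiplicity of \<open>p\<close> is at least
  \<open>z / (p powr (1 + \<sigma>) - 1)\<close>. Weighted by \<open>ln p\<close> and summed over
  \<open>F\<close>, these series stay below that of \<open>ln n\<close>, hence below
  \<open>(z - 1/2) / \<sigma>\<close>. Division by \<open>z\<close> and
  \<open>\<sigma> * z \<le> 1 + \<sigma>\<close> finish the proof.\<close>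

lemma sum_ln_prime_powr_le:
  fixes \<sigma> :: real
  assumes \<sigma>: "\<sigma> > 0" and F: "finite F" "\<And>p. p \<in> F \<Longrightarrow> prime p"
  shows "(\<Sum>p\<in>F. ln (real p) / (real p powr (1 + \<sigma>) - 1)) \<le> 1 / \<sigma> - 1 / (2 * (1 + \<sigma>))"
proof -
  define g where "g n = real n powr -(1 + \<sigma>)" for n :: nat
  define Z where "Z M = (\<Sum>n=1..M. g n)" for M
  define V where "V p M = (\<Sum>n=1..M. real (multiplicity p n) * g n)" for p M
  have g0: "g n \<ge> 0" for n by (simp add: g_def)
  have V0: "V p M \<ge> 0" for p M unfolding V_def by (intro sum_nonneg) (auto simp: g0)
  have Z_le: "Z M \<le> 1 + 1 / \<sigma>" for M
  proof (cases "M \<ge> 1")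
    case True
    have "0 \<le> real M powr -\<sigma> / \<sigma>" using \<sigma> by simp
    with sum_powr_le[OF \<sigma> True] show ?thesis unfolding Z_def g_def by linarith
  qed (use \<sigma> in \<open>simp add: Z_def\<close>)
  have VF: "(\<Sum>p\<in>G. ln (real p) * V p M) \<le> (Z M - 1/2) / \<sigma>"
    if G: "finite G" "\<And>p. p \<in> G \<Longrightarrow> prime p" and M: "M \<ge> 1" for G M
  proof -
    have "(\<Sum>p\<in>G. ln (real p) * V p M)
        = (\<Sum>p\<in>G. \<Sum>n=1..M. (real (multiplicity p n) * ln (real p)) * g n)"
      by (simp add: V_def sum_distrib_left mult_ac)
    also have "\<dots> = (\<Sum>n=1..M. \<Sum>p\<in>G. (real (multiplicity p n) * ln (real p)) * g n)"
      by (rule sum.swap)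
    also have "\<dots> = (\<Sum>n=1..M. (\<Sum>p\<in>G. real (multiplicity p n) * ln (real p)) * g n)"
      by (simp add: sum_distrib_right)
    also have "\<dots> \<le> (\<Sum>n=1..M. ln (real n) * g n)"
      using sum_multiplicity_ln_le[OF _ G] by (intro sum_mono mult_right_mono g0) auto
    also have "\<dots> \<le> (Z M - 1/2) / \<sigma>"
    proof -
      have "0 \<le> ln (real M)" "0 \<le> 1 / (2 * real M)" using M by auto
      hence "1/2 \<le> (harm M :: real)" using harm_lower[OF M] by linarith
      hence "0 \<le> (harm M - 1/2) * real M powr -\<sigma>" by simp
      with sum_ln_powr_le[OF \<sigma> M] have "\<sigma> * (\<Sum>n=1..M. ln (real n) * g n) \<le> Z M - 1/2"
        unfolding Z_def g_def by linarith
      thus ?thesis using \<sigma> by (simp add: field_simps)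
    qed
    finally show ?thesis .
  qed
  have "incseq Z" unfolding Z_def by (intro incseq_SucI) (simp add: g0)
  then obtain z where z: "Z \<longlonglongrightarrow> z" "\<And>M. Z M \<le> z"
    using Z_le incseq_convergent[of Z "1 + 1 / \<sigma>"] by metis
  have "Z 1 = 1" by (simp add: Z_def g_def)
  hence z1: "z \<ge> 1" using z(2)[of 1] by simp
  have zu: "z \<le> 1 + 1 / \<sigma>" using z(1) Z_le by (intro LIMSEQ_le_const2) auto
  have "\<exists>v. V p \<longlonglongrightarrow> v \<and> z / (real p powr (1 + \<sigma>) - 1) \<le> v" if p: "prime p" for p
  proof -
    have p2: "p \<ge> 2" using p by (simp add: prime_ge_2_nat)
    hence lp: "ln (real p) > 0" by simp
    \<comment> \<open>A crude bound from \<open>VF\<close> for the single prime \<open>p\<close>,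
      serving only the convergence of the monotone sequence \<open>V p\<close>.\<close>
    have "V p M \<le> (1 + 1 / \<sigma>) / \<sigma> / ln (real p)" for M
    proof (cases "M \<ge> 1")
      case True
      have "ln (real p) * V p M \<le> (Z M - 1/2) / \<sigma>" using VF[of "{p}" M] p True by simp
      also have "\<dots> \<le> (1 + 1 / \<sigma>) / \<sigma>"
        using Z_le[of M] \<sigma> by (intro divide_right_mono) auto
      finally show ?thesis using lp by (simp only: pos_le_divide_eq mult.commute)
    qed (use \<sigma> lp in \<open>simp add: V_def\<close>)
    moreover have "incseq (V p)" unfolding V_def by (intro incseq_SucI) (simp add: g0)
    ultimately obtain v where v: "V p \<longlonglongrightarrow> v"
      using incseq_convergent[of "V p"] by metis
    \<comment> \<open>The multiples \<open>p * n\<close> have multiplicity one more than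
      \<open>n\<close>. In the limit this reads
      \<open>p powr -(1 + \<sigma>) * (v + z) \<le> v\<close>, which is solved for
      \<open>v\<close>.\<close>
    have step: "real p powr -(1 + \<sigma>) * (V p M + Z M) \<le> V p (p * M)" for M
    proof -
      have "real p powr -(1 + \<sigma>) * (V p M + Z M)
          = (\<Sum>n=1..M. real (multiplicity p (p * n)) * g (p * n))"
        unfolding V_def Z_def sum.distrib[symmetric] sum_distrib_left
      proof (intro sum.cong refl)
        fix n assume "n \<in> {1..M}"
        moreover from this have "multiplicity p (p * n) = Suc (multiplicity p n)"
          using p by (intro multiplicity_times_same) auto
        ultimately show "real p powr -(1 + \<sigma>) * (real (multiplicity p n) * g n + g n)
            = real (multiplicity p (p * n)) * g (p * n)"
          by (simp add: g_def powr_mult algebra_simps)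
      qed
      also have "\<dots> = (\<Sum>n\<in>(*) p ` {1..M}. real (multiplicity p n) * g n)"
        using p2 by (subst sum.reindex) (auto simp: inj_on_def)
      also have "\<dots> \<le> V p (p * M)"
        unfolding V_def using p2 by (intro sum_mono2) (auto simp: g0)
      finally show ?thesis .
    qed
    have "(\<lambda>M. V p (p * M)) \<longlonglongrightarrow> v"
      using LIMSEQ_subseq_LIMSEQ[OF v, of "\<lambda>M. p * M"] p2
      by (auto simp: strict_mono_def o_def)
    moreover have "(\<lambda>M. real p powr -(1 + \<sigma>) * (V p M + Z M))
        \<longlonglongrightarrow> real p powr -(1 + \<sigma>) * (v + z)"
      by (intro tendsto_intros v z)
    ultimately have le: "real p powr -(1 + \<sigma>) * (v + z) \<le> v"
      using step by (intro LIMSEQ_le) auto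
    have P1: "real p powr (1 + \<sigma>) > 1" using p2 \<sigma> by (intro gr_one_powr) auto
    have "v + z = real p powr (1 + \<sigma>) * (real p powr -(1 + \<sigma>) * (v + z))"
      using p2 by (simp add: flip: mult.assoc powr_add)
    also have "\<dots> \<le> real p powr (1 + \<sigma>) * v"
      using le P1 by (intro mult_left_mono) auto
    finally have "v + z \<le> v * real p powr (1 + \<sigma>)" by (simp only: mult.commute)
    hence "z / (real p powr (1 + \<sigma>) - 1) \<le> v"
      using P1 by (simp add: field_simps)
    with v show ?thesis by blast
  qed
  then obtain v where v: "\<And>p. prime p \<Longrightarrow> V p \<longlonglongrightarrow> v p"
      "\<And>p. prime p \<Longrightarrow> z / (real p powr (1 + \<sigma>) - 1) \<le> v p"
    by metis
  have "(\<Sum>p\<in>F. ln (real p) * v p) \<le> (z - 1/2) / \<sigma>"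
  proof (rule LIMSEQ_le)
    show "(\<lambda>M. \<Sum>p\<in>F. ln (real p) * V p M) \<longlonglongrightarrow> (\<Sum>p\<in>F. ln (real p) * v p)"
      using F v by (intro tendsto_intros) auto
    show "(\<lambda>M. (Z M - 1/2) / \<sigma>) \<longlonglongrightarrow> (z - 1/2) / \<sigma>"
      using \<sigma> by (intro tendsto_intros z) auto
    show "\<exists>N. \<forall>n\<ge>N. (\<Sum>p\<in>F. ln (real p) * V p n) \<le> (Z n - 1/2) / \<sigma>"
      using VF[OF F] by (intro exI[of _ 1]) auto
  qed
  moreover have "z * (\<Sum>p\<in>F. ln (real p) / (real p powr (1 + \<sigma>) - 1))
      \<le> (\<Sum>p\<in>F. ln (real p) * v p)"
    unfolding sum_distrib_left
  proof (intro sum_mono)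
    fix p assume "p \<in> F"
    hence p: "prime p" by (rule F)
    have "ln (real p) * (z / (real p powr (1 + \<sigma>) - 1)) \<le> ln (real p) * v p"
      using v(2)[OF p] prime_gt_0_nat[OF p] by (intro mult_left_mono) auto
    thus "z * (ln (real p) / (real p powr (1 + \<sigma>) - 1)) \<le> ln (real p) * v p"
      by (simp add: mult_ac)
  qed
  ultimately have "z * (\<Sum>p\<in>F. ln (real p) / (real p powr (1 + \<sigma>) - 1)) \<le> (z - 1/2) / \<sigma>"
    by linarith
  hence "(\<Sum>p\<in>F. ln (real p) / (real p powr (1 + \<sigma>) - 1)) \<le> ((z - 1/2) / \<sigma>) / z"
    using z1 by (subst pos_le_divide_eq) (simp_all add: mult.commute)
  also have "\<dots> = 1 / \<sigma> - 1 / (2 * (\<sigma> * z))"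
    using z1 \<sigma> by (simp add: divide_simps)
  also have "\<dots> \<le> 1 / \<sigma> - 1 / (2 * (1 + \<sigma>))"
  proof -
    have "\<sigma> * z \<le> 1 + \<sigma>" using mult_left_mono[OF zu, of \<sigma>] \<sigma> by (simp add: algebra_simps)
    hence "1 / (2 * (1 + \<sigma>)) \<le> 1 / (2 * (\<sigma> * z))"
      using z1 \<sigma> by (intro divide_left_mono) auto
    thus ?thesis by linarith
  qed
  finally show ?thesis .
qed

section \<open>Numerical estimates\<close>

lemma ln_numeric_bounds:
  shows "69/100 \<le> ln (2::real)" "ln (2::real) \<le> 25/36" "1 \<le> ln (3::real)" "ln (3::real) \<le> 11/10"
proof -
  show "69/100 \<le> ln (2::real)"
    using ln_approx_bounds[of 2 2] by (simp add: eval_nat_numeral)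
  show "ln (2::real) \<le> 25/36" by (rule ln2_le_25_over_36)
  show "1 \<le> ln (3::real)" using exp_le by (subst ln_ge_iff) auto
  show "ln (3::real) \<le> 11/10"
    using ln_approx_bounds[of 3 3] by (simp add: eval_nat_numeral)
qed

text \<open>Near coincidences such as \<open>5 ^ 3\<close> and \<open>2 ^ 7\<close> compare
  logarithms of primes with multiples of \<open>ln 2\<close>.\<close>

lemma ln_mult_le_of_power_le:
  assumes "real a ^ k \<le> real b ^ j" "a > 0" "b > 0"
  shows "real k * ln (real a) \<le> real j * ln (real b)"
proof -
  have "ln (real a ^ k) \<le> ln (real b ^ j)" using assms by (subst ln_le_cancel_iff) auto
  thus ?thesis using assms by (simp add: ln_realpow)
qed

text \<open>Telescoping in steps of 2, for odd \<open>x\<close>, from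
  \<open>1 / ((x - 1) * (x - 3)) = (1 / (x - 3) - 1 / (x - 1)) / 2\<close>. The summand 1 next to
  \<open>ln x\<close> pays for the growth from \<open>ln x\<close> to
  \<open>ln (x + 2)\<close>.\<close>

lemma ln_div_telescope:
  fixes x :: real
  assumes "x > 3"
  shows "ln x / ((x - 1) * (x - 2)) \<le> (ln x + 1) / (2 * (x - 3)) - (ln (x + 2) + 1) / (2 * (x - 1))"
proof -
  have "ln (x + 2) - ln x \<le> (x + 2 - x) / x" using assms by (intro ln_diff_le) auto
  hence l: "ln (x + 2) \<le> ln x + 2 / x" by simp
  have l0: "ln x \<ge> 0" using assms by simp
  have "ln x / ((x - 1) * (x - 2)) + 1 / (x * (x - 1)) \<le> ln x / ((x - 1) * (x - 3)) + 1 / ((x - 3) * (x - 1))"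
    using assms l0 by (intro add_mono frac_le mult_mono) auto
  also have "\<dots> = (ln x + 1) / (2 * (x - 3)) - (ln x + 1) / (2 * (x - 1))"
    using assms by (simp add: divide_simps) (simp add: algebra_simps)
  finally have "ln x / ((x - 1) * (x - 2)) \<le> (ln x + 1) / (2 * (x - 3)) - (ln x + 1) / (2 * (x - 1)) - 1 / (x * (x - 1))"
    by linarith
  also have "\<dots> = (ln x + 1) / (2 * (x - 3)) - (ln x + 2 / x + 1) / (2 * (x - 1))"
    using assms by (simp add: divide_simps) (simp add: algebra_simps)
  also have "\<dots> \<le> (ln x + 1) / (2 * (x - 3)) - (ln (x + 2) + 1) / (2 * (x - 1))"
    using assms l by (intro diff_left_mono divide_right_mono) auto
  finally show ?thesis .
qed

lemma sum_ln_prime_div_le: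
  assumes "finite F" "\<And>p. p \<in> F \<Longrightarrow> prime p \<and> p \<ge> 5"
  shows "(\<Sum>p\<in>F. ln (real p) / ((real p - 1) * (real p - 2))) \<le> 21/50"
proof -
  define h where "h x = ln x / ((x - 1) * (x - 2))" for x :: real
  define G where "G x = (ln x + 1) / (2 * (x - 3))" for x :: real
  define K where "K = Max (insert 5 F)"
  have K5: "5 \<le> K" unfolding K_def using assms(1) by (intro Max_ge) auto
  have FK: "p \<le> K" if "p \<in> F" for p using that assms(1) by (simp add: K_def)
  have tele: "(\<Sum>k\<in>{5..<m}. h (2 * real k + 1)) \<le> G 11 - G (2 * real m + 1)" if "m \<ge> 5" for m
    using that
  proof (induction m rule: dec_induct)
    case (step m)
    have "h (2 * real m + 1) \<le> G (2 * real m + 1) - G (2 * real m + 1 + 2)"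
      using ln_div_telescope[of "2 * real m + 1"] step(1) by (simp add: h_def G_def)
    with step show ?case by (simp add: add.commute)
  qed simp
  \<comment> \<open>Primes beyond 7 are replaced by all odd integers from 11 on;
    \<open>k = 4\<close> is excluded because 9 is composite.\<close>
  have "F \<subseteq> {5, 7} \<union> (\<lambda>k. 2 * k + 1) ` {5..<Suc K}"
  proof
    fix p assume p: "p \<in> F"
    hence pp: "prime p" "p \<ge> 5" using assms(2) by auto
    have "odd p" using pp prime_odd_nat by auto
    then obtain k where k: "p = 2 * k + 1" by (elim oddE)
    moreover have "k \<noteq> 4" using pp k by auto
    ultimately have "p = 5 \<or> p = 7 \<or> k \<ge> 5" using pp by auto
    thus "p \<in> {5, 7} \<union> (\<lambda>k. 2 * k + 1) ` {5..<Suc K}" using FK[OF p] k by auto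
  qed
  hence "(\<Sum>p\<in>F. h (real p)) \<le> (\<Sum>p\<in>{5, 7} \<union> (\<lambda>k. 2 * k + 1) ` {5..<Suc K}. h (real p))"
    by (intro sum_mono2) (auto simp: h_def)
  also have "\<dots> = h 5 + h 7 + (\<Sum>k\<in>{5..<Suc K}. h (2 * real k + 1))"
    by (subst sum.union_disjoint) (auto simp: sum.reindex inj_on_def add.commute)
  also have "\<dots> \<le> h 5 + h 7 + G 11"
  proof -
    have "G (2 * real (Suc K) + 1) \<ge> 0" unfolding G_def
      using K5 by (intro divide_nonneg_nonneg) auto
    moreover have "Suc K \<ge> 5" using K5 by simp
    ultimately show ?thesis using tele[of "Suc K"] by linarith
  qed
  also have "\<dots> \<le> 21/50"
  proof -
    \<comment> \<open>From \<open>5 ^ 3 \<le> 2 ^ 7\<close>, \<open>7 ^ 6 \<le> 2 ^ 17\<close> and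
      \<open>11 ^ 2 \<le> 2 ^ 7\<close>. The total is about 0.4165.\<close>
    have "ln (5::real) \<le> 163/100" "ln (7::real) \<le> 197/100" "ln (11::real) \<le> 244/100"
      using ln_mult_le_of_power_le[of 5 3 2 7] ln_mult_le_of_power_le[of 7 6 2 17]
        ln_mult_le_of_power_le[of 11 2 2 7] ln_numeric_bounds(2) by simp_all
    moreover have "h 5 = ln 5 / 12" "h 7 = ln 7 / 30" "G 11 = ln 11 / 16 + 1/16"
      by (simp_all add: h_def G_def add_divide_distrib)
    ultimately show ?thesis by linarith
  qed
  finally show ?thesis by (simp add: h_def)
qed

text \<open>The tangent to \<open>exp\<close> at \<open>1 - ln 2\<close> gives the optimal constant \<open>e ln 2 / 2 = 0.942\<dots>\<close>.\<close>

lemma inverse_Suc_ge_two_powr: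
  fixes \<sigma> :: real
  assumes "\<sigma> > 0"
  shows "93/100 * 2 powr -\<sigma> \<le> 1 / (1 + \<sigma>)"
proof -
  have "(1 + 1/8 + (1/8)^2/2) ^ 8 \<le> exp (1/8 :: real) ^ 8"
    by (intro power_mono exp_lower_Taylor_quadratic) auto
  also have "\<dots> = exp 1" by (simp flip: exp_of_nat_mult)
  finally have e: "27/10 \<le> exp (1 :: real)" by (simp add: power_divide eval_nat_numeral)
  \<comment> \<open>\<open>93/100\<close> rounds down
    \<open>27/20 * 69/100 = 0.9315\<close>.\<close>
  have "93/100 * (1 + \<sigma>) \<le> (27/10 / 2 * ln 2) * (1 + \<sigma>)"
    using ln_numeric_bounds(1) assms by (intro mult_right_mono) auto
  also have "\<dots> \<le> (exp 1 / 2 * ln 2) * (1 + \<sigma>)"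
    using e assms by (intro mult_right_mono) auto
  also have "\<dots> = exp (1 - ln 2) * (1 + (\<sigma> * ln 2 - (1 - ln 2)))"
    by (simp add: exp_diff algebra_simps)
  also have "\<dots> \<le> exp (1 - ln 2) * exp (\<sigma> * ln 2 - (1 - ln 2))"
    by (intro mult_left_mono exp_ge_add_one_self) auto
  also have "\<dots> = 2 powr \<sigma>"
    by (simp add: powr_def flip: exp_add)
  finally show ?thesis using assms by (simp add: powr_minus field_simps)
qed

text \<open>
  With \<open>y = z\<^sup>1\<^sup>/\<^sup>2\<close> we have \<open>w \<le> y\<^sup>3\<close> and \<open>v \<le> y\<^sup>4\<close>.  After division by \<open>z\<close>, tangent lines at
  \<open>y\<^sup>3 = 3/5\<close> and \<open>z = 18/25\<close>, close to the critical point, reduce the claim to a positive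
  definite quadratic in \<open>y\<close>.
\<close>

lemma small_primes_inequality:
  fixes \<sigma> :: real
  assumes "\<sigma> > 0"
  defines "w \<equiv> 3 powr -\<sigma>" and "v \<equiv> 5 powr -\<sigma>" and "z \<equiv> 2 powr -\<sigma>"
  shows "ln 3 * (w * (2 - w) / (3 - w)) + 21/50 * (v * (2 - v))
    \<le> ln 2 * (z / (2 - z)) + 1 / (2 * (1 + \<sigma>))"
proof -
  define y where "y = 2 powr (-\<sigma> / 2)"
  have y: "0 < y" "y < 1" using assms(1) by (auto simp: y_def intro: powr_less_one)
  have zy: "z = y\<^sup>2" by (simp add: y_def z_def power2_eq_square flip: powr_add)
  have z: "0 < z" "z < 1" using y unfolding zy by (auto simp: power_less_one_iff)
  have "w = exp (-\<sigma> * ln 3)" "v = exp (-\<sigma> * ln 5)" by (simp_all add: w_def v_def powr_def)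
  moreover have "y ^ 3 = exp (-\<sigma> * (3 / 2 * ln 2))" "y ^ 4 = exp (-\<sigma> * (2 * ln 2))"
    by (simp_all add: y_def powr_def flip: exp_of_nat_mult)
  \<comment> \<open>These are \<open>2 ^ 3 \<le> 3 ^ 2\<close> and
    \<open>2 ^ 2 \<le> 5\<close>.\<close>
  moreover have "3 / 2 * ln 2 \<le> ln (3::real)" "2 * ln 2 \<le> ln (5::real)"
    using ln_mult_le_of_power_le[of 2 3 3 2] ln_mult_le_of_power_le[of 2 2 5 1] by auto
  ultimately have w: "w \<le> y ^ 3" "0 < w" and v: "v \<le> y ^ 4" "0 < v"
    using assms(1) by auto
  define u where "u = y ^ 3"
  have u: "0 < u" "u < 1" using y by (auto simp: u_def power_less_one_iff)
  \<comment> \<open>Factored form of the monotonicity of \<open>x * (2 - x) / (3 - x)\<close> on the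
    unit interval.\<close>
  have "0 \<le> (u - w) * (6 - 3 * (u + w) + u * w)"
    using w u by (intro mult_nonneg_nonneg) (auto simp: u_def[symmetric] intro!: add_nonneg_nonneg)
  hence "w * (2 - w) * (3 - u) \<le> u * (2 - u) * (3 - w)" by (simp add: algebra_simps)
  hence "w * (2 - w) / (3 - w) \<le> u * (2 - u) / (3 - u)"
    using w u by (simp add: u_def[symmetric] field_simps)
  also have "u * (2 - u) / (3 - u) = u * ((2 - u) / (3 - u))" by simp
  also have "\<dots> \<le> u * (7/12 - 25/144 * (u - 3/5))"
  proof -
    have "(2 - u) / (3 - u) \<le> 7/12 - 25/144 * (u - 3/5)"
    proof -
      have "(2 - u) * 144 \<le> (99 - 25 * u) * (3 - u)"
        using zero_le_power2[of "5 * u - 3"] by (simp add: algebra_simps power2_eq_square)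
      hence "(2 - u) / (3 - u) \<le> (99 - 25 * u) / 144"
        using u by (simp add: divide_simps)
      also have "\<dots> = 7/12 - 25/144 * (u - 3/5)" by (simp add: field_simps)
      finally show ?thesis .
    qed
    thus ?thesis using u by (intro mult_left_mono) auto
  qed
  finally have t3: "w * (2 - w) / (3 - w) \<le> u * (7/12 - 25/144 * (u - 3/5))" .
  have r0: "0 \<le> w * (2 - w) / (3 - w)" using w u by (auto simp: u_def[symmetric])
  have T3: "ln 3 * (w * (2 - w) / (3 - w)) \<le> 11/10 * (u * (7/12 - 25/144 * (u - 3/5)))"
    using ln_numeric_bounds(4) t3 r0 by (intro mult_mono) auto
  have vz: "v \<le> z\<^sup>2" using v by (simp add: zy)
  have z2: "z\<^sup>2 < 1" using z by (simp add: power_less_one_iff)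
  have "0 \<le> (z\<^sup>2 - v) * (2 - z\<^sup>2 - v)" using vz v z2 by (intro mult_nonneg_nonneg) auto
  hence T5: "v * (2 - v) \<le> z\<^sup>2 * (2 - z\<^sup>2)" by (simp add: algebra_simps)
  have "25/32 + 625/1024 * (z - 18/25) \<le> 1 / (2 - z)"
  proof -
    have "(1750 + 3125 * z) * (2 - z) \<le> 5120"
      using zero_le_power2[of "z - 18/25"] by (simp add: algebra_simps power2_eq_square)
    hence "(1750 + 3125 * z) / 5120 \<le> 1 / (2 - z)"
      using z by (simp add: divide_simps)
    moreover have "25/32 + 625/1024 * (z - 18/25) = (1750 + 3125 * z) / 5120"
      by (simp add: field_simps)
    ultimately show ?thesis by (simp only:)
  qed
  hence "69/100 * (z * (25/32 + 625/1024 * (z - 18/25))) \<le> 69/100 * (z * (1 / (2 - z)))"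
    using z by (intro mult_left_mono) auto
  also have "\<dots> \<le> ln 2 * (z / (2 - z))"
    using z ln_numeric_bounds(1) by (intro mult_mono) auto
  finally have T2: "69/100 * (z * (25/32 + 625/1024 * (z - 18/25))) \<le> ln 2 * (z / (2 - z))" .
  have T0: "93/200 * z \<le> 1 / (2 * (1 + \<sigma>))"
  proof -
    have "93/200 * z = 93/100 * z / 2" by simp
    also have "\<dots> \<le> 1 / (1 + \<sigma>) / 2"
      using inverse_Suc_ge_two_powr[OF assms(1)] unfolding z_def by (rule divide_right_mono) simp
    also have "\<dots> = 1 / (2 * (1 + \<sigma>))"
      by (simp only: divide_divide_eq_left mult.commute)
    finally show ?thesis .
  qed
  \<comment> \<open>\<open>f1\<close>, \<open>f2\<close> and \<open>f3\<close> are tangent bounds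
    for \<open>z ^ 3\<close> and \<open>z ^ 2\<close> at \<open>18/25\<close> and for
    \<open>z = y ^ 2\<close> at \<open>37/50\<close>, near the minimum of the remaining quadratic.
    They reduce the claim to a linear one in \<open>y < 1\<close>.\<close>
  have "0 \<le> (z - 18/25)\<^sup>2 * (z + 36/25)" using z by simp
  also have "\<dots> = z * z * z - 972/625 * z + 11664/15625"
    by (simp add: power2_eq_square field_simps)
  finally have f1: "0 \<le> z * z * z - 972/625 * z + 11664/15625" .
  have f2: "0 \<le> z * z - 36/25 * z + 324/625"
    using zero_le_power2[of "z - 18/25"] by (simp add: power2_eq_square field_simps)
  have f3: "0 \<le> z - 37/25 * y + 1369/2500"
    using zero_le_power2[of "y - 37/50"] zy by (simp add: power2_eq_square field_simps)
  have "11/10 * (11/16 * y - 25/144 * (z * z)) + 21/50 * (2 * z - z * z * z)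
      \<le> 69/100 * (175/512 + 625/1024 * z) + 93/200"
  proof -
    have ineq: "11/10 * (11/16 * y - 25/144 * b) + 21/50 * (2 * z - c) \<le> 69/100 * (175/512 + 625/1024 * z) + 93/200"
      if "0 \<le> c - 972/625 * z + 11664/15625" "0 \<le> b - 36/25 * z + 324/625" for b c
      using that f3 y(2) by (simp add: field_simps)
    show ?thesis using f1 f2 by (rule ineq)
  qed
  hence "z * (11/10 * (11/16 * y - 25/144 * (z * z)) + 21/50 * (2 * z - z * z * z))
      \<le> z * (69/100 * (175/512 + 625/1024 * z) + 93/200)"
    using z by (intro mult_left_mono) auto
  moreover have "z * (11/10 * (11/16 * y - 25/144 * (z * z)) + 21/50 * (2 * z - z * z * z))
     = 11/10 * (u * (7/12 - 25/144 * (u - 3/5))) + 21/50 * (z\<^sup>2 * (2 - z\<^sup>2))"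
    unfolding u_def zy by (simp add: field_simps power_numeral_reduce)
  moreover have "z * (69/100 * (175/512 + 625/1024 * z) + 93/200)
     = 69/100 * (z * (25/32 + 625/1024 * (z - 18/25))) + 93/200 * z"
    by (simp add: field_simps)
  ultimately show ?thesis
    using T3 T5 T2 T0 by linarith
qed

section \<open>The prime sum with weights 1 / (p - 2)\<close>

lemma odd_prime_ge_3: "prime p \<Longrightarrow> odd p \<Longrightarrow> p \<ge> 3" for p :: nat
  using prime_ge_2_nat[of p] by (cases "p = 2") auto

text \<open>Replacing \<open>1 / (p powr (1 + \<sigma>) - 1)\<close> by
  \<open>p powr -\<sigma> / (p - 2)\<close> costs \<open>r p\<close>. This cost is kept exactly for
  3 and bounded collectively from 5 on; the term of 2 and the saving
  \<open>1 / (2 * (1 + \<sigma>))\<close> absorb it.\<close>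

lemma sum_ln_prime_powr_div_le:
  fixes \<sigma> :: real
  assumes \<sigma>: "\<sigma> > 0" and F: "finite F" "\<And>p. p \<in> F \<Longrightarrow> prime p \<and> odd p"
  shows "(\<Sum>p\<in>F. ln (real p) / (real p - 2) * real p powr -\<sigma>) \<le> 1 / \<sigma>"
proof -
  define w where "w p = real p powr -\<sigma>" for p :: nat
  define r where "r p = w p * (2 - w p) / ((real p - 2) * (real p - w p))" for p
  have w01: "0 < w p" "w p < 1" if "p \<ge> 2" for p
    using that \<sigma> by (auto simp: w_def intro!: powr_less_one)
  have inv: "1 / (real p powr (1 + \<sigma>) - 1) = w p / (real p - w p)" if "p \<ge> 2" for p
  proof -
    have "real p powr (1 + \<sigma>) = real p / w p"
      using that by (simp add: w_def powr_add powr_minus field_simps)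
    also have "\<dots> - 1 = (real p - w p) / w p"
      using w01[OF that] by (simp add: diff_divide_distrib)
    finally show ?thesis by simp
  qed
  have split: "1 / (real p - 2) * w p = 1 / (real p powr (1 + \<sigma>) - 1) + r p" if "p \<ge> 3" for p
    using w01[of p] that unfolding r_def
    by (subst inv) (auto simp: divide_simps, simp add: algebra_simps)
  \<comment> \<open>Adjoining 3 only enlarges the sum and allows its correction to be split off
    without cases.\<close>
  define G where "G = insert 3 F"
  have G: "finite G" "\<And>p. p \<in> G \<Longrightarrow> prime p \<and> odd p" using F by (auto simp: G_def)
  have G3: "p \<ge> 3" if "p \<in> G" for p using odd_prime_ge_3 G(2)[OF that] by auto
  have "(\<Sum>p\<in>F. ln (real p) / (real p - 2) * w p) \<le> (\<Sum>p\<in>G. ln (real p) / (real p - 2) * w p)"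
    using G G3 w01 by (intro sum_mono2) (auto simp: G_def less_imp_le)
  also have "\<dots> = (\<Sum>p\<in>G. ln (real p) / (real p powr (1 + \<sigma>) - 1) + ln (real p) * r p)"
  proof (intro sum.cong refl)
    fix p assume "p \<in> G"
    have "ln (real p) / (real p - 2) * w p = ln (real p) * (1 / (real p - 2) * w p)" by simp
    also have "\<dots> = ln (real p) / (real p powr (1 + \<sigma>) - 1) + ln (real p) * r p"
      unfolding split[OF G3[OF \<open>p \<in> G\<close>]] by (simp add: distrib_left)
    finally show "ln (real p) / (real p - 2) * w p
      = ln (real p) / (real p powr (1 + \<sigma>) - 1) + ln (real p) * r p" .
  qed
  also have "\<dots> = (\<Sum>p\<in>G. ln (real p) / (real p powr (1 + \<sigma>) - 1)) + (\<Sum>p\<in>G. ln (real p) * r p)"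
    by (rule sum.distrib)
  also have "(\<Sum>p\<in>G. ln (real p) / (real p powr (1 + \<sigma>) - 1))
      \<le> 1 / \<sigma> - 1 / (2 * (1 + \<sigma>)) - ln 2 * (w 2 / (2 - w 2))"
  proof -
    have "2 \<notin> G" using G(2)[of 2] by auto
    moreover have "(\<Sum>p\<in>insert 2 G. ln (real p) / (real p powr (1 + \<sigma>) - 1))
        \<le> 1 / \<sigma> - 1 / (2 * (1 + \<sigma>))"
      using \<sigma> G by (intro sum_ln_prime_powr_le) auto
    ultimately show ?thesis
      using G inv[of 2] by (simp add: divide_inverse)
  qed
  also have "(\<Sum>p\<in>G. ln (real p) * r p)
      \<le> ln 3 * (w 3 * (2 - w 3) / (3 - w 3)) + 21/50 * (w 5 * (2 - w 5))"
  proof -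
    have "3 \<in> G" by (simp add: G_def)
    hence "(\<Sum>p\<in>G. ln (real p) * r p) = ln 3 * r 3 + (\<Sum>p\<in>G - {3}. ln (real p) * r p)"
      using G by (subst sum.remove[of G 3]) auto
    also have "(\<Sum>p\<in>G - {3}. ln (real p) * r p)
        \<le> (\<Sum>p\<in>G - {3}. ln (real p) / ((real p - 1) * (real p - 2)) * (w 5 * (2 - w 5)))"
    proof (intro sum_mono)
      fix p assume p: "p \<in> G - {3}"
      hence "odd p" "p \<ge> 3" "p \<noteq> 3" using G G3 by auto
      hence p5: "p \<ge> 5" by (cases "p = 4") auto
      have "w p \<le> w 5" unfolding w_def using p5 \<sigma> by (intro powr_mono2') auto
      \<comment> \<open>Factored form of the monotonicity of \<open>x * (2 - x)\<close> on the unit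
        interval.\<close>
      hence "0 \<le> (w 5 - w p) * (2 - w 5 - w p)"
        using w01[of p] w01[of 5] p5 by (intro mult_nonneg_nonneg) auto
      hence "w p * (2 - w p) \<le> w 5 * (2 - w 5)" by (simp add: algebra_simps)
      moreover have "(real p - 1) * (real p - 2) \<le> (real p - 2) * (real p - w p)"
        using w01[of p] p5 by (subst mult.commute, intro mult_left_mono) auto
      ultimately have "r p \<le> w 5 * (2 - w 5) / ((real p - 1) * (real p - 2))"
        unfolding r_def using w01[of 5] p5 by (intro frac_le) auto
      hence "ln (real p) * r p \<le> ln (real p) * (w 5 * (2 - w 5) / ((real p - 1) * (real p - 2)))"
        using p5 by (intro mult_left_mono) auto
      thus "ln (real p) * r p \<le> ln (real p) / ((real p - 1) * (real p - 2)) * (w 5 * (2 - w 5))"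
        by simp
    qed
    also have "\<dots> = (\<Sum>p\<in>G - {3}. ln (real p) / ((real p - 1) * (real p - 2))) * (w 5 * (2 - w 5))"
      by (simp add: sum_distrib_right)
    also have "\<dots> \<le> 21/50 * (w 5 * (2 - w 5))"
    proof (intro mult_right_mono sum_ln_prime_div_le)
      fix p assume p: "p \<in> G - {3}"
      hence "odd p" "p \<ge> 3" "p \<noteq> 3" using G G3 by auto
      hence "p \<ge> 5" by (cases "p = 4") auto
      thus "prime p \<and> p \<ge> 5" using p G by auto
    qed (use G w01[of 5] in auto)
    finally show ?thesis by (simp add: r_def)
  qed
  finally have "(\<Sum>p\<in>F. ln (real p) / (real p - 2) * w p) \<le>
     1 / \<sigma> - 1 / (2 * (1 + \<sigma>)) - ln 2 * (w 2 / (2 - w 2)) +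
     (ln 3 * (w 3 * (2 - w 3) / (3 - w 3)) + 21/50 * (w 5 * (2 - w 5)))" by simp
  also have "\<dots> \<le> 1 / \<sigma>"
    using small_primes_inequality[OF \<sigma>] by (simp add: w_def)
  finally show ?thesis by (simp add: w_def)
qed

text \<open>Integrate the hypothesis against \<open>\<sigma> * exp (-S * \<sigma>)\<close> over the
  positive half-line.\<close>

lemma sum_div_square_le_of_laplace:
  fixes c l :: "'a \<Rightarrow> real"
  assumes F: "finite F" "\<And>p. p \<in> F \<Longrightarrow> l p \<ge> 0" and S: "S > 0"
    and le: "\<And>\<sigma>. \<sigma> > 0 \<Longrightarrow> (\<Sum>p\<in>F. c p * exp (-\<sigma> * l p)) \<le> 1 / \<sigma>"
  shows "(\<Sum>p\<in>F. c p / (S + l p)\<^sup>2) \<le> 1 / S"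
proof -
  \<comment> \<open>\<open>A a \<sigma>\<close> is the integral of \<open>t * exp (-a * t)\<close>
    over \<open>[0, \<sigma>]\<close>, and \<open>K\<close> is the corresponding integral of right
    side minus left side. So \<open>K\<close> starts at 0, is nondecreasing and tends to the desired
    difference.\<close>
  define A where "A a \<sigma> = 1 / a\<^sup>2 - exp (-a * \<sigma>) * (\<sigma> / a + 1 / a\<^sup>2)" for a \<sigma> :: real
  define K where "K \<sigma> = (1 - exp (-S * \<sigma>)) / S - (\<Sum>p\<in>F. c p * A (S + l p) \<sigma>)" for \<sigma>
  have dA: "(A a has_real_derivative \<sigma> * exp (-a * \<sigma>)) (at \<sigma>)" if "a > 0" for a \<sigma>
    unfolding A_def [abs_def] using that
    by (auto intro!: derivative_eq_intros simp: field_simps power2_eq_square)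
  have dK: "(K has_real_derivative exp (-S * \<sigma>) - (\<Sum>p\<in>F. c p * (\<sigma> * exp (-(S + l p) * \<sigma>)))) (at \<sigma>)" for \<sigma>
    unfolding K_def [abs_def] using F(2) S
    by (auto intro!: derivative_eq_intros dA add_pos_nonneg sum.cong simp: mult_ac)
  have K0: "K \<sigma> \<ge> 0" if "\<sigma> \<ge> 0" for \<sigma>
  proof -
    have "K 0 \<le> K \<sigma>"
    proof (rule DERIV_nonneg_imp_nondecreasing[OF that])
      fix x :: real assume x: "0 \<le> x" "x \<le> \<sigma>"
      have "(\<Sum>p\<in>F. c p * (x * exp (-(S + l p) * x))) = exp (-S * x) * (x * (\<Sum>p\<in>F. c p * exp (-x * l p)))"
        unfolding sum_distrib_left by (intro sum.cong refl) (simp add: algebra_simps flip: exp_add)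
      also have "\<dots> \<le> exp (-S * x) * 1"
      proof (intro mult_left_mono)
        show "x * (\<Sum>p\<in>F. c p * exp (-x * l p)) \<le> 1"
          using le[of x] x by (cases "x = 0") (auto simp: field_simps)
      qed auto
      finally show "\<exists>y. (K has_real_derivative y) (at x) \<and> y \<ge> 0"
        using dK[of x] by (intro exI conjI) auto
    qed
    moreover have "K 0 = 0" by (simp add: K_def A_def)
    ultimately show ?thesis by simp
  qed
  have lA: "(A a \<longlongrightarrow> 1 / a\<^sup>2) at_top" if "a > 0" for a
    unfolding A_def [abs_def] using that by real_asymp
  have lS: "((\<lambda>\<sigma>. (1 - exp (-S * \<sigma>)) / S) \<longlongrightarrow> 1 / S) at_top"
    using S by (real_asymp simp: inverse_eq_divide)
  have "(K \<longlongrightarrow> 1 / S - (\<Sum>p\<in>F. c p * (1 / (S + l p)\<^sup>2))) at_top"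
    unfolding K_def [abs_def] using F(2) S by (intro tendsto_intros lA lS) (auto intro: add_pos_nonneg)
  hence "0 \<le> 1 / S - (\<Sum>p\<in>F. c p * (1 / (S + l p)\<^sup>2))"
    by (rule tendsto_lowerbound) (auto intro!: eventually_mono[OF eventually_ge_at_top[of 0]] K0)
  thus ?thesis by simp
qed

lemma sum_ln_prime_div_square_le:
  fixes S :: real
  assumes "S > 0" "finite F" "\<And>p. p \<in> F \<Longrightarrow> prime p \<and> odd p"
  shows "(\<Sum>p\<in>F. ln (real p) / (real p - 2) / (S + ln (real p))\<^sup>2) \<le> 1 / S"
proof (rule sum_div_square_le_of_laplace)
  fix \<sigma> :: real assume "\<sigma> > 0"
  have "(\<Sum>p\<in>F. ln (real p) / (real p - 2) * exp (-\<sigma> * ln (real p)))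
      = (\<Sum>p\<in>F. ln (real p) / (real p - 2) * real p powr -\<sigma>)"
    using assms(3) by (intro sum.cong refl) (auto simp: powr_def dest: prime_gt_0_nat)
  also have "\<dots> \<le> 1 / \<sigma>" using \<open>\<sigma> > 0\<close> assms by (intro sum_ln_prime_powr_div_le) auto
  finally show "(\<Sum>p\<in>F. ln (real p) / (real p - 2) * exp (-\<sigma> * ln (real p))) \<le> 1 / \<sigma>" .
next
  fix p assume "p \<in> F"
  thus "ln (real p) \<ge> 0" using assms(3) prime_ge_1_nat by fastforce
qed (use assms in auto)

lemma sum_ln_prime_div_mult_le:
  assumes "finite F" "\<And>p. p \<in> F \<Longrightarrow> prime p \<and> odd p"
  shows "(\<Sum>p\<in>F. ln (real p) / (real p * (real p - 2))) \<le> 1"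
proof -
  have "(\<Sum>p\<in>F. ln (real p) / (real p * (real p - 2)))
    = (\<Sum>p\<in>F. ln (real p) / (real p - 2) * real p powr -1)"
    by (intro sum.cong refl) (simp add: powr_minus field_simps)
  also have "\<dots> \<le> 1" using sum_ln_prime_powr_div_le[of 1, OF _ assms] by simp
  finally show ?thesis .
qed

section \<open>The removal weights\<close>

text \<open>\<open>excess\<close> and \<open>removal_weight\<close> are \<open>D\<close> and \<open>J\<close> of the introduction.\<close>

definition excess :: "nat \<Rightarrow> real" where
  "excess n = (\<Sum>p\<in>prime_factors n. real (multiplicity p n) * (ln (real p) / (real p - 2)))"

definition removal_weight :: "nat \<Rightarrow> nat \<Rightarrow> real" where
  "removal_weight m p = real (multiplicity p m) *
     (ln (real p) * (1 + 1 / (real p - 2)) / (ln (real m) + excess m)\<^sup>2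
      + ln (real p) / (real p - 2) / ((ln (real m) + excess m) * ln (real m)))"

lemma odd_prime_factor_ge_3:
  fixes n p :: nat
  assumes "odd n" "p \<in> prime_factors n"
  shows "p \<ge> 3"
proof -
  have "p dvd n" "prime p" using assms by auto
  moreover from this have "odd p" using assms(1) dvd_trans by blast
  ultimately show ?thesis by (simp add: odd_prime_ge_3)
qed

lemma excess_nonneg: "odd n \<Longrightarrow> excess n \<ge> 0"
  unfolding excess_def by (intro sum_nonneg) (use odd_prime_factor_ge_3 in fastforce)

lemma excess_mult_prime:
  assumes "n > 0" "prime p"
  shows "excess (n * p) = excess n + ln (real p) / (real p - 2)"
proof -
  define P where "P = insert p (prime_factors n)"
  have P: "finite P" "p \<in> P" by (auto simp: P_def)
  have pf: "prime_factors (n * p) \<subseteq> P"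
    using assms by (auto simp: P_def prime_factors_product prime_prime_factors)
  have "excess (n * p) = (\<Sum>q\<in>P. real (multiplicity q (n * p)) * (ln (real q) / (real q - 2)))"
    unfolding excess_def using pf assms
    by (intro sum.mono_neutral_left P) (auto simp: P_def prime_factors_multiplicity)
  also have "\<dots> = (\<Sum>q\<in>P. real (multiplicity q n) * (ln (real q) / (real q - 2))
      + (if q = p then ln (real p) / (real p - 2) else 0))"
  proof (intro sum.cong refl)
    fix q assume "q \<in> P"
    hence q: "prime q" using assms by (auto simp: P_def)
    show "real (multiplicity q (n * p)) * (ln (real q) / (real q - 2)) =
      real (multiplicity q n) * (ln (real q) / (real q - 2)) + (if q = p then ln (real p) / (real p - 2) else 0)"
      using q assms by (auto simp: prime_elem_multiplicity_mult_distrib prime_multiplicity_other distrib_right add_divide_distrib)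
  qed
  also have "\<dots> = (\<Sum>q\<in>P. real (multiplicity q n) * (ln (real q) / (real q - 2))) + ln (real p) / (real p - 2)"
    using P by (simp add: sum.distrib)
  also have "(\<Sum>q\<in>P. real (multiplicity q n) * (ln (real q) / (real q - 2))) = excess n"
    unfolding excess_def using assms
    by (intro sum.mono_neutral_right P) (auto simp: P_def prime_factors_multiplicity)
  finally show ?thesis .
qed

lemma removal_weight_nonneg:
  assumes "odd m" "p \<in> prime_factors m"
  shows "removal_weight m p \<ge> 0"
proof -
  have "p \<ge> 3" using odd_prime_factor_ge_3 assms by blast
  moreover have "m \<ge> 1" using assms by (cases m) auto
  moreover have "excess m \<ge> 0" by (rule excess_nonneg) fact
  ultimately show ?thesis unfolding removal_weight_def
    by (intro mult_nonneg_nonneg add_nonneg_nonneg divide_nonneg_nonneg) auto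
qed

text \<open>Makes the transition probabilities add up to 1. The multiplicities sum to
  \<open>L\<close> and \<open>D\<close>, and with \<open>S = L + D\<close> the total is
  \<open>L / S^2 + D / S^2 + D / (S * L) = 1 / L\<close>.\<close>

lemma sum_removal_weight:
  assumes "odd m" "m > 1"
  shows "(\<Sum>p\<in>prime_factors m. removal_weight m p) = 1 / ln (real m)"
proof -
  define L where "L = ln (real m)"
  define D where "D = excess m"
  have L: "L > 0" using assms by (simp add: L_def)
  have D: "D \<ge> 0" using excess_nonneg assms by (simp add: D_def)
  have "(\<Sum>p\<in>prime_factors m. removal_weight m p)
     = (\<Sum>p\<in>prime_factors m. real (multiplicity p m) * ln (real p) * (1 / (L + D)\<^sup>2)
        + real (multiplicity p m) * (ln (real p) / (real p - 2)) * (1 / (L + D)\<^sup>2 + 1 / ((L + D) * L)))"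
    unfolding removal_weight_def L_def[symmetric] D_def[symmetric]
    by (intro sum.cong refl) (simp add: algebra_simps add_divide_distrib)
  also have "\<dots> = L * (1 / (L + D)\<^sup>2) + D * (1 / (L + D)\<^sup>2 + 1 / ((L + D) * L))"
    unfolding sum.distrib sum_distrib_right[symmetric]
    using ln_eq_sum_multiplicity[of m] assms by (simp add: L_def D_def excess_def)
  also have "\<dots> = 1 / L"
  proof -
    have "L * (1 / S\<^sup>2) + (S - L) * (1 / S\<^sup>2 + 1 / (S * L)) = 1 / L" if "S > 0" for S
      using L that by (simp add: field_simps power2_eq_square)
    from this[of "L + D"] show ?thesis using L D by simp
  qed
  finally show ?thesis by (simp add: L_def)
qed

text \<open>At \<open>m = n * p\<close> with \<open>l = ln p\<close>, the quantities
  \<open>L\<close> and \<open>S\<close> become \<open>L + l\<close> and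
  \<open>S + (1 + \<alpha>) * l\<close>. The first bound keeps the decay in \<open>l\<close> of the
  leading term; the other two remove the dependence on \<open>p\<close>, using
  \<open>l \<ge> 1\<close>.\<close>

lemma inverse_shift_le:
  fixes L D l \<alpha> :: real
  assumes "L > 0" "D \<ge> 0" "l \<ge> 1" "\<alpha> \<ge> 0"
  defines "S \<equiv> L + D"
  shows "(1 + \<alpha>) / (S + (1 + \<alpha>) * l)\<^sup>2 + \<alpha> / ((S + (1 + \<alpha>) * l) * (L + l))
    \<le> (1 + 2 * \<alpha>) / (S + l)\<^sup>2 + \<alpha> * D / ((S + 1)\<^sup>2 * (L + 1))" (is ?A)
    and "1 / (S + (1 + \<alpha>) * l)\<^sup>2 \<le> 1 / ((S + 1) * (L + 1))" (is ?B)
    and "1 / ((S + (1 + \<alpha>) * l) * (L + l)) \<le> 1 / ((S + 1) * (L + 1))" (is ?C)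
proof -
  define T where "T = S + (1 + \<alpha>) * l"
  have S: "S > 0" "S \<ge> L" using assms by (auto simp: S_def)
  have T: "T \<ge> S + l" using assms by (simp add: T_def algebra_simps)
  have q1: "(1 + \<alpha>) / T\<^sup>2 \<le> (1 + \<alpha>) / (S + l)\<^sup>2"
    using T S assms by (intro divide_left_mono power_mono mult_pos_pos) auto
  have "\<alpha> / (T * (L + l)) \<le> \<alpha> / ((S + l) * (L + l))"
    using T S assms by (intro divide_left_mono mult_right_mono mult_pos_pos) auto
  \<comment> \<open>The difference of the factors \<open>S + l\<close> and \<open>L + l\<close> is
    \<open>D\<close>, which leaves an error proportional to \<open>D\<close>.\<close>
  also have "\<dots> = \<alpha> / (S + l)\<^sup>2 + \<alpha> * D / ((S + l)\<^sup>2 * (L + l))"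
  proof -
    have "\<alpha> / (x * y) = \<alpha> / x\<^sup>2 + \<alpha> * (x - y) / (x\<^sup>2 * y)" if "x > 0" "y > 0" for x y :: real
      using that by (simp add: field_simps power2_eq_square)
    from this[of "S + l" "L + l"] show ?thesis using S assms by simp
  qed
  also have "\<dots> \<le> \<alpha> / (S + l)\<^sup>2 + \<alpha> * D / ((S + 1)\<^sup>2 * (L + 1))"
    using S assms by (intro add_left_mono divide_left_mono mult_mono power_mono mult_pos_pos) auto
  finally show ?A using q1 unfolding T_def[symmetric]
    by (simp add: add_divide_distrib)
  have "(S + 1) * (L + 1) \<le> T * T" using T S assms by (intro mult_mono) auto
  thus ?B unfolding T_def[symmetric] power2_eq_square
    using T S assms by (intro divide_left_mono mult_pos_pos) auto
  show ?C unfolding T_def[symmetric]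
    using T S assms by (intro divide_left_mono mult_mono mult_pos_pos) auto
qed

text \<open>In the multiplicity \<open>a p + 1\<close> of \<open>p\<close> in \<open>n * p\<close>,
  the summand 1 contributes at most \<open>1 / S + E\<close> and \<open>a p\<close> at most
  \<open>D * B\<close> in total. The slack \<open>1 / L - 1 / S = D / (S * L)\<close> covers
  \<open>E + D * B\<close>.\<close>

lemma sum_removal_weight_mult_le:
  assumes n: "odd n" "n > 1" and F: "finite F" "\<And>p. p \<in> F \<Longrightarrow> prime p \<and> odd p"
  shows "(\<Sum>p\<in>F. removal_weight (n * p) p / real p) \<le> 1 / ln (real n)"
proof -
  define L where "L = ln (real n)"
  define D where "D = excess n"
  define S where "S = L + D"
  define \<alpha> where "\<alpha> p = 1 / (real p - 2)" for p :: nat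
  define B where "B = 1 / ((S + 1) * (L + 1))"
  define E where "E = D / ((S + 1)\<^sup>2 * (L + 1))"
  define a where "a p = real (multiplicity p n)" for p
  have L: "L > 0" using n by (simp add: L_def)
  have D: "D \<ge> 0" using excess_nonneg n by (simp add: D_def)
  have S: "S > 0" "S \<ge> L" using L D by (auto simp: S_def)
  have p3: "p \<ge> 3" if "p \<in> F" for p using odd_prime_ge_3 F(2)[OF that] by blast
  have l1: "ln (real p) \<ge> 1" if "p \<in> F" for p
  proof -
    have "ln 3 \<le> ln (real p)" using p3[OF that] by simp
    thus ?thesis using ln_numeric_bounds(3) by linarith
  qed
  have \<alpha>: "\<alpha> p \<ge> 0" "(1 + \<alpha> p) / real p + \<alpha> p / real p = \<alpha> p" if "p \<in> F" for p
    using p3[OF that] by (auto simp: \<alpha>_def field_simps)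
  have "(\<Sum>p\<in>F. removal_weight (n * p) p / real p)
     \<le> (\<Sum>p\<in>F. ln (real p) / (real p - 2) / (S + ln (real p))\<^sup>2
          + ln (real p) / (real p * (real p - 2)) * E + a p * (ln (real p) / (real p - 2)) * B)"
  proof (intro sum_mono)
    fix p assume p: "p \<in> F"
    define l where "l = ln (real p)"
    have pp: "prime p" "p > 0" using F p p3[OF p] by auto
    have l: "l \<ge> 1" using l1[OF p] by (simp add: l_def)
    have lm: "ln (real (n * p)) = L + l" using n pp by (simp add: L_def l_def ln_mult)
    have em: "excess (n * p) = D + \<alpha> p * l"
      using excess_mult_prime[of n p] n pp by (simp add: D_def \<alpha>_def l_def)
    have mm: "real (multiplicity p (n * p)) = a p + 1"
      using pp n by (simp add: a_def prime_elem_multiplicity_mult_distrib)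
    define X where "X = (1 + \<alpha> p) / (S + (1 + \<alpha> p) * l)\<^sup>2"
    define Y where "Y = \<alpha> p / ((S + (1 + \<alpha> p) * l) * (L + l))"
    have sm: "ln (real (n * p)) + excess (n * p) = S + (1 + \<alpha> p) * l"
      unfolding lm em by (simp add: S_def algebra_simps)
    have "removal_weight (n * p) p = (a p + 1) * (l * (X + Y))"
      unfolding removal_weight_def sm unfolding lm mm X_def Y_def
      by (simp add: \<alpha>_def l_def distrib_left)
    hence "removal_weight (n * p) p / real p = l / real p * (X + Y) + a p * (l / real p * (X + Y))"
      by (simp add: algebra_simps add_divide_distrib)
    also have "\<dots> \<le> l / real p * ((1 + 2 * \<alpha> p) / (S + l)\<^sup>2 + \<alpha> p * E) + a p * (l * \<alpha> p * B)"
    proof (rule add_mono[OF mult_left_mono mult_left_mono])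
      show "X + Y \<le> (1 + 2 * \<alpha> p) / (S + l)\<^sup>2 + \<alpha> p * E"
        using inverse_shift_le(1)[OF L D l \<alpha>(1)[OF p]] by (simp add: X_def Y_def E_def S_def)
      have "X = (1 + \<alpha> p) * (1 / (S + (1 + \<alpha> p) * l)\<^sup>2)" by (simp add: X_def)
      also have "\<dots> \<le> (1 + \<alpha> p) * B"
        using inverse_shift_le(2)[OF L D l \<alpha>(1)[OF p]] \<alpha>(1)[OF p]
        by (intro mult_left_mono) (auto simp: B_def S_def)
      finally have 1: "X \<le> (1 + \<alpha> p) * B" .
      have "Y = \<alpha> p * (1 / ((S + (1 + \<alpha> p) * l) * (L + l)))" by (simp add: Y_def)
      also have "\<dots> \<le> \<alpha> p * B"
        using inverse_shift_le(3)[OF L D l \<alpha>(1)[OF p]] \<alpha>(1)[OF p]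
        by (intro mult_left_mono) (auto simp: B_def S_def)
      finally have "X + Y \<le> (1 + \<alpha> p) * B + \<alpha> p * B" using 1 by simp
      hence "l / real p * (X + Y) \<le> l / real p * ((1 + \<alpha> p) * B + \<alpha> p * B)"
        using l by (intro mult_left_mono) auto
      also have "\<dots> = l * ((1 + \<alpha> p) / real p + \<alpha> p / real p) * B"
        by (simp add: algebra_simps add_divide_distrib)
      finally show "l / real p * (X + Y) \<le> l * \<alpha> p * B" by (simp only: \<alpha>(2)[OF p])
    qed (use l in \<open>auto simp: a_def\<close>)
    also have "l / real p * ((1 + 2 * \<alpha> p) / (S + l)\<^sup>2 + \<alpha> p * E)
       = l * ((1 + 2 * \<alpha> p) / real p) / (S + l)\<^sup>2 + l * \<alpha> p / real p * E"
    proof -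
      have "c / d * (u / x + v * e) = c * (u / d) / x + c * v / d * e" for c d u x v e :: real
        by (simp add: distrib_left mult_ac)
      thus ?thesis .
    qed
    also have "l * \<alpha> p / real p = l / (real p * (real p - 2))"
      by (simp add: \<alpha>_def mult.commute)
    also have "(1 + 2 * \<alpha> p) / real p = 1 / (real p - 2)"
      using p3[OF p] by (simp add: \<alpha>_def field_simps)
    finally show "removal_weight (n * p) p / real p \<le> ln (real p) / (real p - 2) / (S + ln (real p))\<^sup>2
          + ln (real p) / (real p * (real p - 2)) * E + a p * (ln (real p) / (real p - 2)) * B"
      by (simp add: l_def \<alpha>_def mult_ac)
  qed
  also have "\<dots> = (\<Sum>p\<in>F. ln (real p) / (real p - 2) / (S + ln (real p))\<^sup>2)
      + (\<Sum>p\<in>F. ln (real p) / (real p * (real p - 2))) * E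
      + (\<Sum>p\<in>F. a p * (ln (real p) / (real p - 2))) * B"
    by (simp add: sum.distrib sum_distrib_right)
  also have "\<dots> \<le> 1 / S + 1 * E + D * B"
  proof (intro add_mono mult_right_mono)
    show "(\<Sum>p\<in>F. ln (real p) / (real p - 2) / (S + ln (real p))\<^sup>2) \<le> 1 / S"
      by (intro sum_ln_prime_div_square_le S F)
    show "(\<Sum>p\<in>F. ln (real p) / (real p * (real p - 2))) \<le> 1"
      by (intro sum_ln_prime_div_mult_le F)
    have "(\<Sum>p\<in>F. a p * (ln (real p) / (real p - 2)))
       = (\<Sum>p\<in>F \<inter> prime_factors n. a p * (ln (real p) / (real p - 2)))"
      using F n by (intro sum.mono_neutral_right) (auto simp: a_def prime_factors_multiplicity)
    also have "\<dots> \<le> D" unfolding D_def excess_def a_def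
      using odd_prime_factor_ge_3[OF n(1)] by (intro sum_mono2) fastforce+
    finally show "(\<Sum>p\<in>F. a p * (ln (real p) / (real p - 2))) \<le> D" .
  qed (use L S D in \<open>auto simp: E_def B_def\<close>)
  also have "\<dots> \<le> 1 / L"
  proof -
    have "D / (x\<^sup>2 * y) + D * (1 / (x * y)) = D * ((x + 1) / (x\<^sup>2 * y))"
      if "x > 0" "y > 0" for x y :: real
      using that by (simp add: field_simps power2_eq_square)
    from this[of "S + 1" "L + 1"] have "E + D * B = D * ((S + 2) / ((S + 1)\<^sup>2 * (L + 1)))"
      using S L by (simp add: E_def B_def add.commute)
    also have "\<dots> \<le> D * (1 / (S * L))"
    proof (intro mult_left_mono D)
      have "(S + 1)\<^sup>2 * (L + 1) - (S + 2) * (S * L) = L + (S + 1)\<^sup>2"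
        by (simp add: power2_eq_square algebra_simps)
      also have "\<dots> \<ge> 0" using L by simp
      finally have "(S + 2) * (S * L) \<le> (S + 1)\<^sup>2 * (L + 1)" by simp
      thus "(S + 2) / ((S + 1)\<^sup>2 * (L + 1)) \<le> 1 / (S * L)"
        using S L by (subst frac_le_eq) (auto simp: divide_le_0_iff)
    qed
    also have "\<dots> = 1 / L - 1 / S" using S L by (simp add: S_def field_simps)
    finally show ?thesis by simp
  qed
  finally show ?thesis by (simp add: L_def)
qed

section \<open>Pushing mass down\<close>

definition semigroup_level :: "nat set \<Rightarrow> nat \<Rightarrow> nat set" where
  "semigroup_level Q j = {n. n > 0 \<and> bigOmega n = j \<and> prime_factors n \<subseteq> Q}"

definition recip_ln :: "nat \<Rightarrow> real" where
  "recip_ln n = 1 / (real n * ln (real n))"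

lemma recip_ln_nonneg: "recip_ln n \<ge> 0"
  by (cases "n = 0") (auto simp: recip_ln_def)

lemma bigOmega_mult_prime:
  "n > 0 \<Longrightarrow> prime p \<Longrightarrow> bigOmega (n * p) = Suc (bigOmega n)"
  by (simp add: bigOmega_def prime_factorization_mult prime_factorization_prime)

lemma bigOmega_1: "bigOmega 1 = 0" "bigOmega (Suc 0) = 0"
  by (simp_all add: bigOmega_def)

lemma odd_if_prime_factors_odd:
  fixes n :: nat
  assumes "n > 0" "prime_factors n \<subseteq> Q" "\<forall>q\<in>Q. prime q \<and> odd q"
  shows "odd n"
proof
  assume "even n"
  hence "2 \<in> Q" using assms(1,2) by (auto simp: prime_factors_dvd)
  thus False using assms(3) by auto
qed

lemma div_prime_factor_dvd:
  fixes m p :: nat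
  assumes "p \<in> prime_factors m"
  shows "m div p dvd m"
  using assms by (metis dvd_div_mult_self dvd_triv_left in_prime_factors_imp_dvd)

text \<open>Mass reaches \<open>n\<close> only from points \<open>n * p\<close>, one for each prime
  \<open>p\<close>. There \<open>u m * ln m \<le> 1 / m = 1 / (n * p)\<close>, so the removal-weight
  bound divided by \<open>n\<close> applies.\<close>

lemma sum_removal_flow_le:
  fixes X :: "nat set"
  assumes Q: "\<forall>q\<in>Q. prime q \<and> odd q" and n: "n > 1" "prime_factors n \<subseteq> Q"
    and X: "finite X" "\<And>m. m \<in> X \<Longrightarrow> m > 0 \<and> prime_factors m \<subseteq> Q"
    and u: "\<And>m. m \<in> X \<Longrightarrow> u m \<le> recip_ln m"
  shows "(\<Sum>m\<in>X. \<Sum>p\<in>prime_factors m. if m div p = n then u m * (removal_weight m p * ln (real m)) else 0)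
    \<le> recip_ln n"
proof -
  have oddn: "odd n" using odd_if_prime_factors_odd[OF _ n(2) Q] n by simp
  define I where "I = (SIGMA m:X. {p \<in> prime_factors m. m div p = n})"
  have finI: "finite I" using X by (auto simp: I_def)
  have I: "m \<in> X" "p \<in> prime_factors m" "m = n * p" "p \<in> Q" "p > 0" if "(m, p) \<in> I" for m p
    using that X(2)[of m] by (auto simp: I_def dvd_div_mult_self prime_factors_dvd prime_gt_0_nat)
  have inj: "inj_on snd I"
  proof (rule inj_onI)
    fix x y assume xy: "x \<in> I" "y \<in> I" "snd x = snd y"
    moreover have "fst x = n * snd x" "fst y = n * snd y"
      using xy(1,2) I(3)[of "fst x" "snd x"] I(3)[of "fst y" "snd y"] by simp_all
    ultimately show "x = y" by (simp add: prod_eq_iff)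
  qed
  have "(\<Sum>m\<in>X. \<Sum>p\<in>prime_factors m. if m div p = n then u m * (removal_weight m p * ln (real m)) else 0)
    = (\<Sum>(m, p)\<in>I. u m * (removal_weight m p * ln (real m)))"
    using X unfolding I_def by (subst sum.Sigma[symmetric]) (auto simp: sum.If_cases Int_def)
  also have "\<dots> \<le> (\<Sum>(m, p)\<in>I. removal_weight (n * p) p / real p / real n)"
  proof (intro sum_mono, clarify)
    fix m p assume mp: "(m, p) \<in> I"
    have oddm: "odd m" using odd_if_prime_factors_odd[OF _ _ Q] X(2)[OF I(1)[OF mp]] by blast
    have "n \<le> m" using I(3,5)[OF mp] by simp
    hence m1: "m > 1" using n by linarith
    have "u m * (removal_weight m p * ln (real m)) \<le> recip_ln m * (removal_weight m p * ln (real m))"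
      using u[OF I(1)[OF mp]] removal_weight_nonneg[OF oddm I(2)[OF mp]] m1
      by (intro mult_right_mono) auto
    also have "\<dots> = removal_weight m p / real m"
      using m1 by (simp add: recip_ln_def)
    also have "\<dots> = removal_weight (n * p) p / real p / real n"
      by (simp add: I(3)[OF mp] mult.commute)
    finally show "u m * (removal_weight m p * ln (real m)) \<le> removal_weight (n * p) p / real p / real n" .
  qed
  also have "\<dots> = (\<Sum>p\<in>snd ` I. removal_weight (n * p) p / real p) / real n"
    by (simp add: sum.reindex[OF inj] sum_divide_distrib case_prod_unfold)
  also have "\<dots> \<le> 1 / ln (real n) / real n"
    using oddn n Q I(4) finI by (intro divide_right_mono sum_removal_weight_mult_le) auto
  finally show ?thesis by (simp add: recip_ln_def mult.commute)
qed

text \<open>Induction on \<open>d\<close>: \<open>X\<close> carries the mass already moved to the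
  top level \<open>k + d\<close>, while \<open>B\<close> holds the elements below that have not yet
  been met. One step moves the mass of \<open>X\<close> down one level and adds the elements of
  \<open>B\<close> found there.\<close>

lemma antichain_mass_le_level:
  fixes X B :: "nat set" and u :: "nat \<Rightarrow> real"
  assumes Q: "\<forall>q\<in>Q. prime q \<and> odd q" and k: "k \<ge> 1"
    and "finite X" "X \<subseteq> semigroup_level Q (k + d)"
    and "\<And>m. m \<in> X \<Longrightarrow> 0 \<le> u m \<and> u m \<le> recip_ln m"
    and "finite B" "B \<subseteq> (\<Union>j\<in>{k..<k + d}. semigroup_level Q j)"
    and "\<And>a b. a \<in> B \<Longrightarrow> b \<in> B \<union> X \<Longrightarrow> a dvd b \<Longrightarrow> a = b"
  shows "\<exists>Y. finite Y \<and> Y \<subseteq> semigroup_level Q k \<and> sum u X + sum recip_ln B \<le> sum recip_ln Y"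
  using assms(3-)
proof (induction d arbitrary: X u B)
  case 0
  hence "sum u X + sum recip_ln B \<le> sum recip_ln X" by (auto intro!: sum_mono)
  thus ?case using 0 by auto
next
  case (Suc d)
  note X = Suc.prems(1,2) and u = Suc.prems(3) and B = Suc.prems(4,5) and anti = Suc.prems(6)
  define T where "T = B \<inter> semigroup_level Q (k + d)"
  define C where "C = (\<Union>m\<in>X. (\<lambda>p. m div p) ` prime_factors m)"
  define P where "P m p = removal_weight m p * ln (real m)" for m p
  define v where "v n = (\<Sum>m\<in>X. \<Sum>p\<in>prime_factors m. if m div p = n then u m * P m p else 0)" for n
  define u' where "u' n = v n + (if n \<in> T then recip_ln n else 0)" for n
  have Xm: "m > 1" "odd m" "bigOmega m = Suc (k + d)" "prime_factors m \<subseteq> Q" if "m \<in> X" for m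
  proof -
    have m: "m > 0" "bigOmega m = Suc (k + d)" "prime_factors m \<subseteq> Q"
      using that X by (auto simp: semigroup_level_def)
    hence "m \<noteq> 1" by (auto simp: bigOmega_1)
    thus "m > 1" "odd m" "bigOmega m = Suc (k + d)" "prime_factors m \<subseteq> Q"
      using m odd_if_prime_factors_odd[OF _ _ Q] by auto
  qed
  have Pn: "P m p \<ge> 0" if "m \<in> X" "p \<in> prime_factors m" for m p
    using removal_weight_nonneg[of m p] Xm[OF that(1)] that(2) by (auto simp: P_def)
  have v0: "v n \<ge> 0" for n
    unfolding v_def using u Pn by (intro sum_nonneg) auto
  have div_level: "m div p \<in> semigroup_level Q (k + d)" if "m \<in> X" "p \<in> prime_factors m" for m p
  proof -
    have mp: "m = m div p * p" "prime p" using that(2) by auto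
    hence pos: "m div p > 0" using Xm(1)[OF that(1)] by (cases "m div p") auto
    have "bigOmega m = Suc (bigOmega (m div p))" using bigOmega_mult_prime[OF pos mp(2)] mp(1) by simp
    moreover have "prime_factors (m div p) \<subseteq> prime_factors m"
      using that Xm(1)[OF that(1)] by (intro dvd_prime_factors div_prime_factor_dvd) auto
    ultimately show ?thesis using Xm[OF that(1)] pos by (auto simp: semigroup_level_def)
  qed
  have fin: "finite C" "finite T" using X B by (auto simp: C_def T_def)
  \<comment> \<open>A point of \<open>T\<close> receiving mass would properly divide some
    \<open>m\<close> in \<open>X\<close>, contrary to \<open>anti\<close>. So its full weight can be
    added.\<close>
  have vT: "v n = 0" if "n \<in> T" for n
  proof -
    have "m div p \<noteq> n" if mp: "m \<in> X" "p \<in> prime_factors m" for m p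
    proof
      assume "m div p = n"
      hence "n dvd m" using mp(2) div_prime_factor_dvd by blast
      hence "n = m" using anti[of n m] \<open>n \<in> T\<close> mp(1) by (auto simp: T_def)
      thus False using \<open>n \<in> T\<close> Xm(3)[OF mp(1)] by (auto simp: T_def semigroup_level_def)
    qed
    thus ?thesis by (simp add: v_def)
  qed
  have u'_bounds: "0 \<le> u' n \<and> u' n \<le> recip_ln n" if n: "n \<in> C \<union> T" for n
  proof (cases "n \<in> T")
    case True
    thus ?thesis using vT recip_ln_nonneg by (simp add: u'_def)
  next
    case False
    hence nl: "n \<in> semigroup_level Q (k + d)" using n div_level by (auto simp: C_def)
    \<comment> \<open>\<open>k \<ge> 1\<close> keeps arrivals away from 1, where
      \<open>recip_ln\<close> takes the default value 0.\<close>
    hence "n \<noteq> 1" "n > 0" using k by (auto simp: semigroup_level_def bigOmega_1)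
    hence "v n \<le> recip_ln n"
      unfolding v_def P_def using nl X u
      by (intro sum_removal_flow_le[OF Q]) (auto simp: semigroup_level_def)
    thus ?thesis using False v0 by (simp add: u'_def)
  qed
  \<comment> \<open>Conservation of mass: exchange the sums and use that the probabilities at each
    \<open>m\<close> add up to 1.\<close>
  have "sum v (C \<union> T) = sum v C"
    using fin vT by (intro sum.mono_neutral_right) auto
  also have "\<dots> = (\<Sum>m\<in>X. \<Sum>n\<in>C. \<Sum>p\<in>prime_factors m. if m div p = n then u m * P m p else 0)"
    unfolding v_def by (rule sum.swap)
  also have "\<dots> = (\<Sum>m\<in>X. \<Sum>p\<in>prime_factors m. \<Sum>n\<in>C. if m div p = n then u m * P m p else 0)"
    by (intro sum.cong refl sum.swap)
  also have "\<dots> = (\<Sum>m\<in>X. \<Sum>p\<in>prime_factors m. u m * P m p)"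
    using fin by (intro sum.cong refl) (auto simp: C_def)
  also have "\<dots> = sum u X"
  proof (intro sum.cong refl)
    fix m assume m: "m \<in> X"
    have "(\<Sum>p\<in>prime_factors m. P m p) = 1"
      using sum_removal_weight[of m] Xm[OF m] by (simp add: P_def flip: sum_distrib_right)
    thus "(\<Sum>p\<in>prime_factors m. u m * P m p) = u m" by (simp flip: sum_distrib_left)
  qed
  finally have "sum v (C \<union> T) = sum u X" .
  moreover have "sum u' (C \<union> T) = sum v (C \<union> T) + (\<Sum>n\<in>C \<union> T. if n \<in> T then recip_ln n else 0)"
    by (simp add: u'_def sum.distrib)
  moreover have "(\<Sum>n\<in>C \<union> T. if n \<in> T then recip_ln n else 0) = sum recip_ln T"
    using fin by (simp add: sum.If_cases Int_absorb1)
  moreover have "sum recip_ln B = sum recip_ln (B - T) + sum recip_ln T"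
    using B by (intro sum.subset_diff) (auto simp: T_def)
  moreover have "\<exists>Y. finite Y \<and> Y \<subseteq> semigroup_level Q k \<and>
      sum u' (C \<union> T) + sum recip_ln (B - T) \<le> sum recip_ln Y"
  proof (rule Suc.IH)
    show "B - T \<subseteq> (\<Union>j\<in>{k..<k + d}. semigroup_level Q j)"
      using B by (fastforce simp: T_def less_Suc_eq)
    \<comment> \<open>A divisor of \<open>m div p\<close> also divides \<open>m\<close>, so
      \<open>anti\<close> would make it equal to \<open>m\<close>, which lies on a higher level than
      \<open>B - T\<close>.\<close>
    show "a = b" if ab: "a \<in> B - T" "b \<in> (B - T) \<union> (C \<union> T)" "a dvd b" for a b
    proof (cases "b \<in> B")
      case True
      thus ?thesis using anti[of a b] ab by auto
    next
      case False
      then obtain m p where mp: "m \<in> X" "p \<in> prime_factors m" "b = m div p"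
        using ab by (auto simp: C_def T_def)
      hence "a dvd m" using ab(3) div_prime_factor_dvd dvd_trans by blast
      hence "a = m" using anti[of a m] ab(1) mp(1) by auto
      moreover have "bigOmega a \<le> k + d" using ab(1) B by (auto simp: semigroup_level_def)
      ultimately show ?thesis using Xm(3)[OF mp(1)] by simp
    qed
  qed (use fin B div_level u'_bounds in \<open>auto simp: C_def T_def\<close>)
  ultimately show ?case by auto
qed

theorem theorem1p3:
  fixes k :: nat and A Q :: "nat set"
  assumes "k \<ge> 1"
    and "A \<subseteq> {n. n \<ge> 1 \<and> bigOmega n \<ge> k}"
    and "primitive A"
    and "\<forall>q\<in>Q. prime q \<and> odd q"
  shows "fsum (restrict_primes A Q)
           \<le> fsum (restrict_primes {n. n \<ge> 1 \<and> bigOmega n = k} Q)"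
proof -
  have level: "restrict_primes {n. n \<ge> 1 \<and> bigOmega n = k} Q = semigroup_level Q k"
    by (auto simp: restrict_primes_def semigroup_level_def)
  \<comment> \<open>As a supremum over finite subsets, the sum over \<open>A\<close> can be bounded
    one finite \<open>B\<close> at a time.\<close>
  have fsum: "fsum Z = (SUP F\<in>{F. finite F \<and> F \<subseteq> Z}. ennreal (sum recip_ln F))" for Z
    unfolding fsum_def recip_ln_def[symmetric]
    by (subst nonneg_infsum_complete) (auto simp: sum_ennreal recip_ln_nonneg intro!: SUP_cong)
  show ?thesis
    unfolding level fsum[of "restrict_primes A Q"]
  proof (intro SUP_least, clarify)
    fix B assume B: "finite B" "B \<subseteq> restrict_primes A Q"
    \<comment> \<open>Puts level \<open>k + d\<close> above all of \<open>B\<close>, so the descent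
      starts from an empty \<open>X\<close>; the inserted 0 covers an empty
      \<open>B\<close>.\<close>
    define d where "d = Suc (Max (insert 0 (bigOmega ` B)))"
    have Bd: "bigOmega b < d" if "b \<in> B" for b
      using B that by (auto simp: d_def less_Suc_eq_le)
    have "\<exists>Y. finite Y \<and> Y \<subseteq> semigroup_level Q k \<and>
        sum (\<lambda>_. 0) ({} :: nat set) + sum recip_ln B \<le> sum recip_ln Y"
    proof (rule antichain_mass_le_level[where u = "\<lambda>_. 0" and X = "{}" and d = d, OF assms(4,1)])
      show "B \<subseteq> (\<Union>j\<in>{k..<k + d}. semigroup_level Q j)"
      proof
        fix b assume b: "b \<in> B"
        hence "b \<in> A" "prime_factors b \<subseteq> Q" using B by (auto simp: restrict_primes_def)
        thus "b \<in> (\<Union>j\<in>{k..<k + d}. semigroup_level Q j)"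
          using assms(2) Bd[OF b] by (auto simp: semigroup_level_def)
      qed
      show "a = b" if "a \<in> B" "b \<in> B \<union> {}" "a dvd b" for a b
        using that B assms(3) by (auto simp: primitive_def restrict_primes_def)
    qed (use B in auto)
    then obtain Y where Y: "finite Y" "Y \<subseteq> semigroup_level Q k" "sum recip_ln B \<le> sum recip_ln Y"
      by auto
    have "ennreal (sum recip_ln B) \<le> ennreal (sum recip_ln Y)" using Y(3) by (rule ennreal_leI)
    also have "\<dots> \<le> fsum (semigroup_level Q k)"
      unfolding fsum using Y by (intro SUP_upper) auto
    finally show "ennreal (sum recip_ln B) \<le> fsum (semigroup_level Q k)" .
  qed
qed

end
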